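(* Let $G$ be a finite simple graph of order $n$, let $S\subseteq V(G)$, and let $\lambda_1$ and $\overline{\lambda}_1$ be the spectral radius (largest eigenvalue) of $G_S$ and $\overline{G_S}$, respectively. Then $$\lambda_1 + \overline{\lambda}_1 \leq n+1 + (\Delta(G) - \delta(G)).$$
   Context: $\Delta(G)$ and $\delta(G)$ are the maximum and minimum degree of $G$. The self-loop graph $G_S$ is obtained from $G$ by attaching one loop at each vertex of $S$; its adjacency matrix is $A(G_S)=A(G)+\mathfrak{I}_S$, where $\mathfrak{I}_S$ is the diagonal $0/1$ matrix with ones exactly at the positions corresponding to $S$. The complement of $G_S$ is defined as $\overline{G_S}:=\overline{G}_S$, i.e. the graph obtained from the usual complement $\overline{G}$ by attaching loops at the vertices of the same set $S$. Eigenvalues are those of the adjacency matrix. *)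

theory Defs
  imports "Graph_Theory.Graph_Theory" "Jordan_Normal_Form.Spectral_Radius"
begin

text \<open>
  A finite simple graph is a \<^locale>\<open>pair_graph\<close>: an undirected edge $\{u,v\}$ is the pair of arcs
  $(u,v)$, $(v,u)$. Attaching a loop at $v$ adds the single arc $(v,v)$, so that a loop
  contributes $1$ to the diagonal of the adjacency matrix.
\<close>

definition self_loop_graph :: "'a pair_pre_digraph \<Rightarrow> 'a set \<Rightarrow> 'a pair_pre_digraph" where
  "self_loop_graph G S = \<lparr> pverts = pverts G, parcs = parcs G \<union> {(v, v) | v. v \<in> S} \<rparr>"

definition complement_graph :: "'a pair_pre_digraph \<Rightarrow> 'a pair_pre_digraph" where
  "complement_graph G = \<lparr> pverts = pverts G,
     parcs = {(u, v). u \<in> pverts G \<and> v \<in> pverts G \<and> u \<noteq> v \<and> (u, v) \<notin> parcs G} \<rparr>"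

text \<open>
  In a symmetric loop-free digraph the out-degree of a vertex is its number of neighbours. The
  maximum and minimum are meaningful only for a finite nonempty vertex set.
\<close>

definition max_degree :: "'a pair_pre_digraph \<Rightarrow> nat" where
  "max_degree G = Max (out_degree (with_proj G) ` pverts G)"

definition min_degree :: "'a pair_pre_digraph \<Rightarrow> nat" where
  "min_degree G = Min (out_degree (with_proj G) ` pverts G)"

text \<open>Rows and columns are indexed along an enumeration \<open>vs\<close> of the vertices.\<close>

definition adjacency_matrix :: "'a list \<Rightarrow> 'a pair_pre_digraph \<Rightarrow> real mat" where
  "adjacency_matrix vs G =
     mat (length vs) (length vs) (\<lambda>(i, j). if (vs ! i, vs ! j) \<in> parcs G then 1 else 0)"

text \<open>
  The eigenvalues of a real symmetric matrix are all real, so its largest eigenvalue is the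
  maximum of its spectrum over the reals. This is the largest eigenvalue itself, not the largest
  modulus of a complex eigenvalue as in the constant \<^const>\<open>spectral_radius\<close>.
\<close>

definition largest_eigenvalue :: "real mat \<Rightarrow> real" where
  "largest_eigenvalue A = Max (spectrum A)"

lemma adjacency_matrix_self_loop_graph:
  assumes "pair_graph G" and "distinct vs" and "set vs = pverts G"
  shows "adjacency_matrix vs (self_loop_graph G S) =
    adjacency_matrix vs G +
    mat (length vs) (length vs) (\<lambda>(i, j). if i = j \<and> vs ! i \<in> S then 1 else 0)"
proof -
  interpret pair_graph G by (rule assms(1))
  have "(v, v) \<notin> parcs G" for v
    using pair_no_loops[of "(v, v)"] by auto
  then show ?thesis
    using assms(2)
    by (intro eq_matI) (auto simp: adjacency_matrix_def self_loop_graph_def nth_eq_iff_index_eq)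
qed

end

theory Submission
  imports Defs
begin

text \<open>
  The largest eigenvalue is at most the largest row sum of the adjacency matrix. The row of a
  vertex \<open>v\<close> sums to at most \<open>deg v + 1 \<le> \<Delta> + 1\<close> in \<open>G\<^sub>S\<close> and to at most
  \<open>(n - 1 - deg v) + 1 \<le> n - \<delta>\<close> in its complement.
\<close>

text \<open>Over the complex numbers an eigenvalue always exists, and symmetry forces it to be real.
  This keeps the spectrum nonempty, so that the \<open>Max\<close> in
  \<open>largest_eigenvalue\<close> is a genuine maximum.\<close>

lemma symmetric_real_mat_eigenvalue_exists:
  fixes A :: "real mat"
  assumes A: "A \<in> carrier_mat n n" and sym: "transpose_mat A = A" and n: "n > 0"
  shows "\<exists>k. eigenvalue A k"
proof -
  define B where "B = map_mat complex_of_real A"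
  have B: "B \<in> carrier_mat n n" using A by (simp add: B_def)
  have symB: "transpose_mat B = B"
    by (metis B_def map_mat_transpose sym)
  obtain k where k: "eigenvalue B k"
    using spectrum_non_empty[OF B n] by (auto simp: spectrum_def)
  then obtain v where v: "v \<in> carrier_vec n" "v \<noteq> 0\<^sub>v n" and Bv: "B *\<^sub>v v = k \<cdot>\<^sub>v v"
    using B by (auto simp: eigenvalue_def eigenvector_def)
  \<comment> \<open>The entries of \<open>B\<close> are real, so conjugating the eigenvalue equation
    leaves \<open>B\<close> unchanged.\<close>
  have conj: "B *\<^sub>v conjugate v = cnj k \<cdot>\<^sub>v conjugate v"
  proof (rule eq_vecI)
    fix i assume "i < dim_vec (cnj k \<cdot>\<^sub>v conjugate v)"
    then have i: "i < n" using v by simp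
    have "(B *\<^sub>v conjugate v) $ i = cnj ((B *\<^sub>v v) $ i)"
      using i v B A by (simp add: scalar_prod_def B_def)
    then show "(B *\<^sub>v conjugate v) $ i = (cnj k \<cdot>\<^sub>v conjugate v) $ i"
      using i v by (simp add: Bv)
  qed (use B v in auto)
  \<comment> \<open>The form \<open>(B *\<^sub>v v) \<bullet> conjugate v\<close> is evaluated
    twice, with \<open>B\<close> acting on either factor. Cancelling \<open>v \<bullet>c v\<close>,
    nonzero because \<open>v\<close> is, gives \<open>k = cnj k\<close>.\<close>
  have "k * (v \<bullet>c v) = (transpose_mat B *\<^sub>v v) \<bullet> conjugate v"
    using v by (simp add: symB Bv)
  also have "\<dots> = v \<bullet> (B *\<^sub>v conjugate v)"
    using B v by (intro transpose_vec_mult_scalar) auto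
  also have "\<dots> = cnj k * (v \<bullet>c v)"
    using v by (simp add: conj)
  finally have "k = cnj k" using v by simp
  then have "k = complex_of_real (Re k)"
    by (simp add: complex_eq_iff)
  \<comment> \<open>The characteristic polynomial of \<open>B\<close> is the image of that of
    \<open>A\<close>, so the real root descends to \<open>A\<close>.\<close>
  then have "poly (map_poly complex_of_real (char_poly A)) (complex_of_real (Re k)) = 0"
    using k eigenvalue_root_char_poly[OF B] of_real_hom.char_poly_hom[OF A]
    by (metis B_def)
  then have "poly (char_poly A) (Re k) = 0" by simp
  then show ?thesis using eigenvalue_root_char_poly[OF A] by blast
qed

text \<open>In the eigenvalue equation, read off the row at which the eigenvector has its entry of
  largest modulus: every other entry is dominated by that one, which then cancels.\<close>

lemma eigenvalue_abs_le_row_sum: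
  fixes A :: "real mat"
  assumes A: "A \<in> carrier_mat n n" and k: "eigenvalue A k"
    and row: "\<And>i. i < n \<Longrightarrow> (\<Sum>j<n. \<bar>A $$ (i, j)\<bar>) \<le> c"
  shows "\<bar>k\<bar> \<le> c"
proof -
  obtain v where v: "v \<in> carrier_vec n" "v \<noteq> 0\<^sub>v n" and Av: "A *\<^sub>v v = k \<cdot>\<^sub>v v"
    using k A by (auto simp: eigenvalue_def eigenvector_def)
  obtain m where m: "m < n" "v $ m \<noteq> 0"
    using v by (metis carrier_vecD eq_vecI index_zero_vec)
  let ?M = "Max ((\<lambda>i. \<bar>v $ i\<bar>) ` {..<n})"
  have "?M \<in> (\<lambda>i. \<bar>v $ i\<bar>) ` {..<n}" using m by (intro Max_in) auto
  then obtain i where i: "i < n" and iM: "\<bar>v $ i\<bar> = ?M" by auto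
  have max: "\<bar>v $ j\<bar> \<le> \<bar>v $ i\<bar>" if "j < n" for j
    unfolding iM using that by (intro Max_ge) auto
  have pos: "\<bar>v $ i\<bar> > 0" using max[OF m(1)] m(2) by linarith
  have "k * v $ i = (A *\<^sub>v v) $ i" using i v by (simp add: Av)
  also have "\<dots> = (\<Sum>j<n. A $$ (i, j) * v $ j)"
    using i v A by (simp add: scalar_prod_def lessThan_atLeast0)
  finally have "\<bar>k\<bar> * \<bar>v $ i\<bar> = \<bar>\<Sum>j<n. A $$ (i, j) * v $ j\<bar>"
    by (simp flip: abs_mult)
  also have "\<dots> \<le> (\<Sum>j<n. \<bar>A $$ (i, j)\<bar> * \<bar>v $ i\<bar>)"
    by (rule order_trans[OF sum_abs], rule sum_mono) (auto simp: abs_mult max mult_left_mono)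
  also have "\<dots> \<le> c * \<bar>v $ i\<bar>"
    using row[OF i] by (simp add: mult_right_mono flip: sum_distrib_right)
  finally show ?thesis using pos by simp
qed

text \<open>The entries are 0 or 1, so an absolute row sum is a neighbour count. Symmetry enters
  through the nonempty spectrum.\<close>

lemma largest_eigenvalue_adjacency_matrix_le:
  assumes vs: "distinct vs" "vs \<noteq> []"
    and sym: "\<And>u v. (u, v) \<in> parcs H \<Longrightarrow> (v, u) \<in> parcs H"
    and deg: "\<And>v. v \<in> set vs \<Longrightarrow> real (card {w \<in> set vs. (v, w) \<in> parcs H}) \<le> d"
  shows "largest_eigenvalue (adjacency_matrix vs H) \<le> d"
proof -
  let ?A = "adjacency_matrix vs H" and ?n = "length vs"
  have A: "?A \<in> carrier_mat ?n ?n" by (simp add: adjacency_matrix_def)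
  have "transpose_mat ?A = ?A"
    using sym by (intro eq_matI) (auto simp: adjacency_matrix_def)
  then have "spectrum ?A \<noteq> {}"
    using symmetric_real_mat_eigenvalue_exists[OF A] vs by (auto simp: spectrum_def)
  moreover have "k \<le> d" if "k \<in> spectrum ?A" for k
  proof -
    have "\<bar>k\<bar> \<le> d"
    proof (rule eigenvalue_abs_le_row_sum[OF A])
      show "eigenvalue ?A k" using that by (simp add: spectrum_def)
    next
      fix i assume i: "i < ?n"
      have "(\<Sum>j<?n. \<bar>?A $$ (i, j)\<bar>) = (\<Sum>j<?n. if (vs ! i, vs ! j) \<in> parcs H then 1 else 0)"
        using i by (intro sum.cong) (auto simp: adjacency_matrix_def)
      \<comment> \<open>Since \<open>vs\<close> is distinct, summing over positions is summing over
        vertices.\<close>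
      also have "\<dots> = (\<Sum>w\<in>set vs. if (vs ! i, w) \<in> parcs H then 1 else 0)"
        by (rule sum.reindex_bij_betw[OF bij_betw_nth[OF vs(1) refl refl]])
      also have "\<dots> = real (card {w \<in> set vs. (vs ! i, w) \<in> parcs H})"
        by (simp add: sum.If_cases Int_def)
      also have "\<dots> \<le> d" using i by (intro deg) simp
      finally show "(\<Sum>j<?n. \<bar>?A $$ (i, j)\<bar>) \<le> d" .
    qed
    then show ?thesis by simp
  qed
  ultimately show ?thesis
    using card_finite_spectrum(1)[OF A] by (simp add: largest_eigenvalue_def)
qed

text \<open>A loop enlarges the neighbourhood of \<open>v\<close> by at most \<open>v\<close>
  itself. A general \<open>H\<close> allows use for both \<open>G\<close> and its
  complement.\<close>

lemma largest_eigenvalue_self_loop_graph_le: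
  assumes vs: "distinct vs" "vs \<noteq> []"
    and sym: "\<And>u v. (u, v) \<in> parcs H \<Longrightarrow> (v, u) \<in> parcs H"
    and deg: "\<And>v. v \<in> set vs \<Longrightarrow> real (card {w \<in> set vs. (v, w) \<in> parcs H}) \<le> d"
  shows "largest_eigenvalue (adjacency_matrix vs (self_loop_graph H S)) \<le> d + 1"
proof (rule largest_eigenvalue_adjacency_matrix_le[OF vs])
  fix v assume v: "v \<in> set vs"
  have "card {w \<in> set vs. (v, w) \<in> parcs (self_loop_graph H S)}
      \<le> card (insert v {w \<in> set vs. (v, w) \<in> parcs H})"
    by (intro card_mono) (auto simp: self_loop_graph_def)
  also have "\<dots> \<le> Suc (card {w \<in> set vs. (v, w) \<in> parcs H})"
    by (rule card_insert_le_m1) auto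
  finally show "real (card {w \<in> set vs. (v, w) \<in> parcs (self_loop_graph H S)}) \<le> d + 1"
    using deg[OF v] by linarith
qed (use sym in \<open>auto simp: self_loop_graph_def\<close>)

text \<open>Links the degrees, which count arcs, to the neighbour counts in the eigenvalue
  bound.\<close>

lemma (in pair_wf_digraph) out_degree_eq_card_neighbours:
  "out_degree (with_proj G) v = card {w \<in> pverts G. (v, w) \<in> parcs G}"
proof -
  have "out_arcs (with_proj G) v = Pair v ` {w \<in> pverts G. (v, w) \<in> parcs G}"
    using in_arcsD2 by (auto simp: out_arcs_def)
  then show ?thesis by (simp add: out_degree_def card_image inj_on_def)
qed

theorem theorem4p6:
  fixes G :: "'a pair_pre_digraph" and S :: "'a set" and vs :: "'a list" and n :: nat
  assumes "pair_graph G"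
    and "n = card (pverts G)" and "n \<ge> 1"
    and "S \<subseteq> pverts G"
    and "distinct vs" and "set vs = pverts G"
  shows "largest_eigenvalue (adjacency_matrix vs (self_loop_graph G S))
       + largest_eigenvalue (adjacency_matrix vs (self_loop_graph (complement_graph G) S))
       \<le> real n + 1 + (real (max_degree G) - real (min_degree G))"
proof -
  interpret pair_graph G by (rule assms(1))
  have fin: "finite (pverts G)" by (metis assms(6) List.finite_set)
  have ne: "vs \<noteq> []" using assms by auto
  have sym: "(v, u) \<in> parcs G" if "(u, v) \<in> parcs G" for u v
    using that arcs_symmetric by blast
  let ?N = "\<lambda>v. {w \<in> pverts G. (v, w) \<in> parcs G}"
  have deg_le: "card (?N v) \<le> max_degree G" and deg_ge: "min_degree G \<le> card (?N v)"
    if "v \<in> pverts G" for v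
    using that fin
    by (simp_all add: max_degree_def min_degree_def out_degree_eq_card_neighbours)
  \<comment> \<open>Complementing turns the minimum degree into an upper bound; the 1 subtracted is
    for \<open>v\<close> itself, which is not its own neighbour in either graph.\<close>
  have comp_deg: "real (card {w \<in> pverts G. (v, w) \<in> parcs (complement_graph G)})
      \<le> real n - 1 - real (min_degree G)" if v: "v \<in> pverts G" for v
  proof -
    have "v \<notin> ?N v" using pair_no_loops[of "(v, v)"] by auto
    moreover have "{w \<in> pverts G. (v, w) \<in> parcs (complement_graph G)}
        = pverts G - insert v (?N v)"
      using v by (auto simp: complement_graph_def)
    \<comment> \<open>Ensures that the natural-number subtraction in \<open>card_Diff_subset\<close>
      does not truncate, so it carries over to the reals.\<close>
    moreover have "card (insert v (?N v)) \<le> n"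
      unfolding assms(2) using v fin by (intro card_mono) auto
    ultimately have "real (card {w \<in> pverts G. (v, w) \<in> parcs (complement_graph G)})
        = real n - 1 - real (card (?N v))"
      using v fin assms(2) by (simp add: card_Diff_subset)
    then show ?thesis using deg_ge[OF v] by simp
  qed
  have "largest_eigenvalue (adjacency_matrix vs (self_loop_graph G S)) \<le> real (max_degree G) + 1"
    using sym deg_le assms(6)
    by (intro largest_eigenvalue_self_loop_graph_le[OF assms(5) ne]) auto
  moreover have "largest_eigenvalue (adjacency_matrix vs (self_loop_graph (complement_graph G) S))
      \<le> real n - 1 - real (min_degree G) + 1"
    using sym comp_deg assms(6)
    by (intro largest_eigenvalue_self_loop_graph_le[OF assms(5) ne])
      (auto simp: complement_graph_def)
  ultimately show ?thesis by linarith
qed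

end
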